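(* The approximation factor $\frac12$ provided for Problem EE by Problem EE* with the self-conjugate balanced complex polytope is sharp: for every $q>\frac12$ there exist $d,N\ge1$ and $\boldsymbol v_0,\ldots,\boldsymbol v_N\in\mathbb C^d$ such that $E(\boldsymbol v_0)\subset\mathrm{co}\{E(\boldsymbol v_1),\ldots,E(\boldsymbol v_N)\}$, but $q\boldsymbol v_0\notin\mathrm{cob}\{\boldsymbol v_1,\ldots,\boldsymbol v_N,\bar{\boldsymbol v}_1,\ldots,\bar{\boldsymbol v}_N\}$.
   Context: For $\boldsymbol v=\boldsymbol a+i\boldsymbol b\in\mathbb C^d$ with $\boldsymbol a,\boldsymbol b\in\mathbb R^d$, $E(\boldsymbol v)=\{\boldsymbol a\cos t+\boldsymbol b\sin t : t\in\mathbb R\}\subset\mathbb R^d$ and $\bar{\boldsymbol v}=\boldsymbol a-i\boldsymbol b$. $\mathrm{co}$ denotes the convex hull of the union of the listed sets. The balanced convex hull of $K\subset\mathbb C^d$ is $$\mathrm{cob}(K)=\Big\{\sum_{k=1}^n z_k\boldsymbol v_k : n\in\mathbb N,\ z_k\in\mathbb C,\ \boldsymbol v_k\in K,\ \sum_{k=1}^n|z_k|\le1\Big\}.$$ Problem EE: decide whether $E(\boldsymbol v_0)\subset\mathrm{co}\{E(\boldsymbol v_1),\ldots,E(\boldsymbol v_N)\}$. Problem EE* (self-conjugate version): decide whether a given point of $\mathbb C^d$ belongs to $\mathrm{cob}\{\boldsymbol v_1,\ldots,\boldsymbol v_N,\bar{\boldsymbol v}_1,\ldots,\bar{\boldsymbol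 v}_N\}$. The factor $\frac12$ refers to the implication: if $E(\boldsymbol v_0)\subset\mathrm{co}\{E(\boldsymbol v_1),\ldots,E(\boldsymbol v_N)\}$, then $\frac12\boldsymbol v_0\in\mathrm{cob}\{\boldsymbol v_1,\ldots,\boldsymbol v_N,\bar{\boldsymbol v}_1,\ldots,\bar{\boldsymbol v}_N\}$. *)

theory Defs
  imports "HOL-Analysis.Analysis" "HOL-Library.Function_Algebras"
begin

text \<open>
  The dimension \<open>d\<close> is existentially quantified, so it cannot be a type.  A vector of
  \<open>\<complex>\<^sup>d\<close> (resp. \<open>\<real>\<^sup>d\<close>) is a function from \<^typ>\<open>nat\<close> that vanishes outside \<open>{..<d}\<close>.
  Real scalar multiplication on functions is taken pointwise, which makes the library's
  \<^const>\<open>convex\<close> and \<^const>\<open>hull\<close> available for such vectors.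
\<close>

instantiation "fun" :: (type, real_vector) real_vector
begin

definition scaleR_fun :: "real \<Rightarrow> ('a \<Rightarrow> 'b) \<Rightarrow> 'a \<Rightarrow> 'b"
  where "scaleR_fun c f = (\<lambda>x. c *\<^sub>R f x)"

instance
  by standard (auto simp: scaleR_fun_def fun_eq_iff scaleR_add_right scaleR_add_left)

end

definition complex_space :: "nat \<Rightarrow> (nat \<Rightarrow> complex) set"
  where "complex_space d = {v. \<forall>j\<ge>d. v j = 0}"

definition conj_vec :: "(nat \<Rightarrow> complex) \<Rightarrow> nat \<Rightarrow> complex"
  where "conj_vec v = (\<lambda>j. cnj (v j))"

definition ellipse :: "(nat \<Rightarrow> complex) \<Rightarrow> (nat \<Rightarrow> real) set"
  where "ellipse v = {(\<lambda>j. Re (v j) * cos t + Im (v j) * sin t) | t. t \<in> (UNIV :: real set)}"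

definition cob :: "(nat \<Rightarrow> complex) set \<Rightarrow> (nat \<Rightarrow> complex) set"
  where "cob K = {(\<lambda>j. \<Sum>k=1..n. z k * w k j) | (n::nat) (z :: nat \<Rightarrow> complex) w.
                    (\<forall>k\<in>{1..n}. w k \<in> K) \<and> (\<Sum>k=1..n. cmod (z k)) \<le> 1}"

end

(*
  Take N points u_k at the angles 2 pi k / N on the real unit circle, regarded as vectors of C^2,
  and v_0 = rho (1, -i) with rho = cos (pi / N).  The ellipse of v_0 is the circle of radius rho,
  which is inscribed in the regular N-gon with vertices u_k.  On the other hand the functional
  (x, y) |-> x + i y has modulus 1 at every u_k = conj u_k, hence is bounded by 1 on the balanced
  hull, while its value at q v_0 is 2 q rho.  As rho tends to 1, this exceeds 1 once N is large.
*)
theory Submission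
  imports Defs
begin

text \<open>Triangle inequality, as the coefficients \<open>z k\<close> have total modulus at most
  1. Used contrapositively: a linear functional whose modulus at \<open>y\<close> exceeds
  \<open>B\<close> separates \<open>y\<close> from the balanced hull.\<close>

lemma cob_functional_bound:
  fixes c :: "nat \<Rightarrow> complex"
  assumes "y \<in> cob K" and "0 \<le> B"
    and K: "\<And>w. w \<in> K \<Longrightarrow> cmod (\<Sum>j<d. c j * w j) \<le> B"
  shows "cmod (\<Sum>j<d. c j * y j) \<le> B"
proof -
  obtain n :: nat and z :: "nat \<Rightarrow> complex" and w
    where y: "y = (\<lambda>j. \<Sum>k=1..n. z k * w k j)" and w: "\<forall>k\<in>{1..n}. w k \<in> K"
      and z: "(\<Sum>k=1..n. cmod (z k)) \<le> 1"
    using assms(1) unfolding cob_def by blast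
  have "(\<Sum>j<d. c j * y j) = (\<Sum>j<d. \<Sum>k=1..n. z k * (c j * w k j))"
    unfolding y by (simp add: sum_distrib_left mult.left_commute)
  also have "\<dots> = (\<Sum>k=1..n. z k * (\<Sum>j<d. c j * w k j))"
    by (subst sum.swap) (simp add: sum_distrib_left)
  also have "cmod \<dots> \<le> (\<Sum>k=1..n. cmod (z k) * B)"
    using w by (intro sum_norm_le) (auto simp: norm_mult intro!: mult_left_mono K)
  also have "\<dots> = (\<Sum>k=1..n. cmod (z k)) * B"
    by (simp add: sum_distrib_right)
  also have "\<dots> \<le> B"
    using mult_right_mono[OF z \<open>0 \<le> B\<close>] by simp
  finally show ?thesis .
qed

text \<open>The missing weight \<open>1 - (a + b)\<close> is put on the origin.\<close>

lemma convex_subconvex_combination: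
  fixes S :: "'a::real_vector set"
  assumes "convex S" "0 \<in> S" "x \<in> S" "y \<in> S" "0 \<le> a" "0 \<le> b" "a + b \<le> 1"
  shows "a *\<^sub>R x + b *\<^sub>R y \<in> S"
proof (cases "a + b = 0")
  case True
  then have "a = 0" "b = 0" using assms by linarith+
  then show ?thesis using assms by simp
next
  case False
  define m where "m = (a / (a + b)) *\<^sub>R x + (b / (a + b)) *\<^sub>R y"
  have "m \<in> S"
    unfolding m_def using assms False by (intro convexD) (auto simp: add_divide_distrib[symmetric])
  then have "(a + b) *\<^sub>R m + (1 - (a + b)) *\<^sub>R 0 \<in> S"
    using assms by (intro convexD) auto
  moreover have "(a + b) *\<^sub>R m = a *\<^sub>R x + b *\<^sub>R y"
    using False by (simp add: m_def scaleR_add_right)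
  ultimately show ?thesis by simp
qed

definition circle_point :: "real \<Rightarrow> nat \<Rightarrow> real"
  where "circle_point t = (\<lambda>j. if j = 0 then cos t else if j = 1 then sin t else 0)"

text \<open>Cramer's rule in the plane: the sine of an angle difference is the determinant of two
  unit vectors. Without division it also covers parallel vectors.\<close>

lemma circle_point_combination:
  "sin (\<beta> - \<alpha>) *\<^sub>R circle_point t
     = sin (\<beta> - t) *\<^sub>R circle_point \<alpha> + sin (t - \<alpha>) *\<^sub>R circle_point \<beta>"
proof -
  have "(sin \<beta> * cos \<alpha> - cos \<beta> * sin \<alpha>) * cos t
      = (sin \<beta> * cos t - cos \<beta> * sin t) * cos \<alpha> + (sin t * cos \<alpha> - cos t * sin \<alpha>) * cos \<beta>"
    "(sin \<beta> * cos \<alpha> - cos \<beta> * sin \<alpha>) * sin t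
      = (sin \<beta> * cos t - cos \<beta> * sin t) * sin \<alpha> + (sin t * cos \<alpha> - cos t * sin \<alpha>) * sin \<beta>"
    by algebra+
  then show ?thesis
    by (auto simp: fun_eq_iff scaleR_fun_def circle_point_def sin_diff)
qed

text \<open>The chord between the two given points has distance \<open>cos \<delta>\<close> from the
  origin, so the arc of that radius stays in the triangle they span with 0.\<close>

lemma inscribed_circle_arc:
  assumes "convex S" "0 \<in> S" "circle_point \<alpha> \<in> S" "circle_point (\<alpha> + 2 * \<delta>) \<in> S"
    and "0 < \<delta>" "\<delta> \<le> pi/2" "\<alpha> \<le> t" "t \<le> \<alpha> + 2 * \<delta>"
  shows "cos \<delta> *\<^sub>R circle_point t \<in> S"
proof -
  \<comment> \<open>Cramer's coefficients times \<open>cos \<delta>\<close>, which cancels against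
    \<open>sin (2 * \<delta>) = 2 * sin \<delta> * cos \<delta>\<close>; so
    \<open>\<delta> = pi/2\<close> causes no division by 0.\<close>
  define a b where "a = sin (\<alpha> + 2 * \<delta> - t) / (2 * sin \<delta>)" and "b = sin (t - \<alpha>) / (2 * sin \<delta>)"
  have s: "sin \<delta> > 0" using assms by (intro sin_gt_zero) auto
  have nonneg: "0 \<le> a" "0 \<le> b"
    using s assms by (auto simp: a_def b_def intro!: divide_nonneg_pos sin_ge_zero)
  \<comment> \<open>Measured from the bisector of the sector, the angle makes
    \<open>sin (\<delta> + x) + sin (\<delta> - x)\<close> equal to
    \<open>2 * sin \<delta> * cos x\<close>.\<close>
  define x where "x = \<alpha> + \<delta> - t"
  have shift: "\<alpha> + 2 * \<delta> - t = \<delta> + x" "t - \<alpha> = \<delta> - x"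
    by (simp_all add: x_def)
  have "a = sin (\<delta> + x) / (2 * sin \<delta>)" "b = sin (\<delta> - x) / (2 * sin \<delta>)"
    unfolding a_def b_def shift by (rule refl)+
  then have "a + b = cos x"
    using s by (simp add: sin_add sin_diff add_divide_distrib[symmetric])
  then have "a + b \<le> 1" by simp
  then have mem: "a *\<^sub>R circle_point \<alpha> + b *\<^sub>R circle_point (\<alpha> + 2 * \<delta>) \<in> S"
    using assms nonneg by (intro convex_subconvex_combination) auto
  have "cos \<delta> *\<^sub>R circle_point t = (1 / (2 * sin \<delta>)) *\<^sub>R (sin (2 * \<delta>) *\<^sub>R circle_point t)"
    using s by (simp add: sin_double)
  also have "\<dots> = a *\<^sub>R circle_point \<alpha> + b *\<^sub>R circle_point (\<alpha> + 2 * \<delta>)"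
    using circle_point_combination[of "\<alpha> + 2 * \<delta>" \<alpha> t]
    by (simp add: a_def b_def scaleR_add_right)
  finally show ?thesis
    using mem by simp
qed

text \<open>Modulo \<open>2 * pi\<close>, every angle lies in one of the \<open>N\<close> sectors
  between consecutive vertices; the arc lemma applies there with \<open>\<delta> = pi / N\<close>,
  and \<open>N \<ge> 2\<close> gives \<open>\<delta> \<le> pi / 2\<close>.\<close>

lemma inscribed_circle:
  fixes N :: nat
  assumes "convex S" "0 \<in> S" "N \<ge> 2"
    and vertices: "\<And>k. k \<in> {1..N} \<Longrightarrow> circle_point (2 * pi * k / N) \<in> S"
  shows "cos (pi / N) *\<^sub>R circle_point t \<in> S"
proof -
  obtain s where s: "0 \<le> s" "s < 2 * pi" "cos t = cos s" "sin t = sin s"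
    using sincos_total_2pi[OF sin_cos_squared_add2[of t]] by blast
  then have eq: "circle_point t = circle_point s" by (simp only: circle_point_def)
  define k where "k = nat \<lfloor>s * N / (2 * pi)\<rfloor>"
  have nonneg: "0 \<le> s * N / (2 * pi)" using s by simp
  then have k: "real k \<le> s * N / (2 * pi)" "s * N / (2 * pi) < real k + 1"
    unfolding k_def by linarith+
  have "s * N / (2 * pi) < N"
    using s assms by (simp add: divide_simps)
  with k have "k < N" by linarith
  \<comment> \<open>The sector index \<open>k\<close> may be 0, while vertices are numbered from 1;
    by periodicity vertex 0 is vertex \<open>N\<close>.\<close>
  have "circle_point (2 * pi * real N / N) = circle_point (2 * pi * real 0 / N)"
    using assms by (simp add: circle_point_def fun_eq_iff)
  then have vert: "circle_point (2 * pi * real i / N) \<in> S" if "i \<le> N" for i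
    using that vertices[of i] vertices[of N] assms(3) by (cases "i = 0") auto
  show ?thesis
    unfolding eq
  proof (rule inscribed_circle_arc[OF assms(1,2) vert[of k]])
    have "2 * pi * real k / N + 2 * (pi / N) = 2 * pi * real (Suc k) / N"
      by (simp add: field_simps add_divide_distrib)
    then show "circle_point (2 * pi * real k / N + 2 * (pi / N)) \<in> S"
      using vert[of "Suc k"] \<open>k < N\<close> by simp
    show "pi / N \<le> pi / 2"
      using assms by (intro divide_left_mono) auto
    show "2 * pi * k / N \<le> s" "s \<le> 2 * pi * real k / N + 2 * (pi / N)"
      using k assms(3) by (simp_all add: field_simps)
  qed (use \<open>k < N\<close> in auto)
qed

theorem theorem6p3:
  fixes q :: real
  assumes "q > 1/2"
  shows "\<exists>(d::nat) (N::nat) (v :: nat \<Rightarrow> nat \<Rightarrow> complex).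
           d \<ge> 1 \<and> N \<ge> 1 \<and> (\<forall>k\<le>N. v k \<in> complex_space d) \<and>
           ellipse (v 0) \<subseteq> convex hull (\<Union>k\<in>{1..N}. ellipse (v k)) \<and>
           (\<lambda>j. complex_of_real q * v 0 j)
             \<notin> cob (v ` {1..N} \<union> (\<lambda>k. conj_vec (v k)) ` {1..N})"
proof -
  have "(\<lambda>N. cos (pi / real N)) \<longlonglongrightarrow> cos 0"
    by (intro tendsto_intros tendsto_divide_0[OF tendsto_const]
        filterlim_real_sequentially[THEN filterlim_at_top_imp_at_infinity])
  \<comment> \<open>This threshold is below 1 because \<open>q > 1/2\<close>; a radius above it
    makes the functional exceed 1 at \<open>q\<close> times \<open>v 0\<close>.\<close>
  moreover have "1 / (2 * q) < cos 0"
    using assms by simp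
  ultimately have "\<forall>\<^sub>F N in sequentially. 1 / (2 * q) < cos (pi / real N)"
    by (rule order_tendstoD)
  then obtain M :: nat where "\<forall>N\<ge>M. 1 / (2 * q) < cos (pi / real N)"
    unfolding eventually_sequentially by blast
  then have "1 / (2 * q) < cos (pi / real (max M 2))" "max M 2 \<ge> 2"
    by simp_all
  then obtain N :: nat where N: "1 / (2 * q) < cos (pi / N)" "N \<ge> 2"
    by blast
  define \<rho> where "\<rho> = cos (pi / N)"
  have \<rho>: "1 < 2 * q * \<rho>"
    using N(1) assms by (simp add: \<rho>_def field_simps)
  \<comment> \<open>With the sign of \<open>- \<i>\<close>, the two terms of the functional add up
    to \<open>2 * \<rho>\<close>; the opposite sign would make them cancel.\<close>
  define v0 :: "nat \<Rightarrow> complex"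
    where "v0 = (\<lambda>j. if j = 0 then of_real \<rho> else if j = 1 then - \<i> * of_real \<rho> else 0)"
  define v :: "nat \<Rightarrow> nat \<Rightarrow> complex"
    where "v k = (if k = 0 then v0 else (\<lambda>j. of_real (circle_point (2 * pi * k / N) j)))" for k
  let ?H = "convex hull (\<Union>k\<in>{1..N}. ellipse (v k))"
  have sub: "(\<lambda>j. Re (v k j) * cos t + Im (v k j) * sin t) \<in> ?H" if "k \<in> {1..N}" for k t
    using that by (intro hull_inc) (auto simp: ellipse_def)
  have vertex: "circle_point (2 * pi * real k / N) \<in> ?H" if "k \<in> {1..N}" for k
    using sub[OF that, of 0] that by (simp add: v_def)
  \<comment> \<open>The ellipse of a real vector is a segment through the origin, reached at
    \<open>t = pi/2\<close>.\<close>
  have "0 \<in> ?H"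
    using sub[of 1 "pi/2"] N(2) by (simp add: v_def zero_fun_def)
  then have circle: "\<rho> *\<^sub>R circle_point t \<in> ?H" for t
    unfolding \<rho>_def using N(2) vertex by (intro inscribed_circle) auto
  \<comment> \<open>The sign of \<open>- \<i>\<close> reverses the orientation, hence the angle
    \<open>- t\<close>.\<close>
  have "(\<lambda>j. Re (v 0 j) * cos t + Im (v 0 j) * sin t) = \<rho> *\<^sub>R circle_point (- t)" for t
    by (auto simp: v_def v0_def circle_point_def scaleR_fun_def fun_eq_iff)
  then have ell: "ellipse (v 0) \<subseteq> ?H"
    using circle by (auto simp: ellipse_def)
  have "(\<lambda>j. complex_of_real q * v 0 j)
          \<notin> cob (v ` {1..N} \<union> (\<lambda>k. conj_vec (v k)) ` {1..N})" (is "?y \<notin> cob ?K")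
  proof
    assume mem: "?y \<in> cob ?K"
    have real_unit: "cmod (of_real (cos t) + \<i> * of_real (sin t)) = 1" for t
      by (metis cis_conv_exp exp_Euler norm_cis cos_of_real sin_of_real)
    \<comment> \<open>The powers \<open>\<i> ^ j\<close> are the coefficients 1 and
      \<open>\<i>\<close>; the vertex at angle t is sent to exp(it).\<close>
    have "cmod (\<Sum>j<2. \<i> ^ j * ?y j) \<le> 1"
      by (rule cob_functional_bound[OF mem])
        (auto simp: v_def conj_vec_def circle_point_def numeral_2_eq_2 real_unit)
    also have "(\<Sum>j<2. \<i> ^ j * ?y j) = of_real (2 * q * \<rho>)"
      by (simp add: v_def v0_def numeral_2_eq_2 complex_eq_iff)
    finally show False
      using \<rho> unfolding norm_of_real by linarith
  qed
  moreover have "\<forall>k\<le>N. v k \<in> complex_space 2"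
    by (auto simp: complex_space_def v_def v0_def circle_point_def)
  ultimately show ?thesis
    using ell N(2) by (intro exI[of _ 2] exI[of _ N] exI[of _ v]) auto
qed

end
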